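(* Let $X$ be a finite-dimensional real Hilbert space, let $Z$ be a nonempty closed convex subset of $X$, and let $(x_n)_{n\in\mathbb{N}}$ be a sequence in $X$ that is Fejér monotone with respect to $Z$. Suppose that $(x_{k_n})_{n\in\mathbb{N}}$ is a subsequence of $(x_n)_{n\in\mathbb{N}}$ that converges to some $\bar z\in Z$ and that, for every $n\in\mathbb{N}$, $x_{k_{n+1}}\neq x_{k_n}$ and $x_{k_n}\neq\bar z$. Then $$\mathcal{C}\left(\left(\frac{x_{k_n}-x_{k_{n+1}}}{\|x_{k_n}-x_{k_{n+1}}\|}\right)_{n\in\mathbb{N}}\right)\cup \mathcal{C}\left(\left(\frac{x_{k_n}-\bar z}{\|x_{k_n}-\bar z\|}\right)_{n\in\mathbb{N}}\right)\subseteq \mathbb{S}\cap N_Z(\bar z);$$ equivalently, $$\lim_{n\to\infty} d_{\mathbb{S}\cap N_Z(\bar z)}\left(\frac{x_{k_n}-x_{k_{n+1}}}{\|x_{k_n}-x_{k_{n+1}}\|}\right)=0\quad\text{and}\quad \lim_{n\to\infty} d_{\mathbb{S}\cap N_Z(\bar z)}\left(\frac{x_{k_n}-\bar z}{\|x_{k_n}-\bar z\|}\right)=0.$$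
   Context: $X$ has inner product $\langle\cdot,\cdot\rangle$ and induced norm $\|\cdot\|$; $\mathbb{N}=\{0,1,2,\ldots\}$. A sequence $(x_n)_{n\in\mathbb{N}}$ in $X$ is Fejér monotone with respect to $C\subseteq X$ if $\|x_{n+1}-c\|\le\|x_n-c\|$ for all $c\in C$ and all $n\in\mathbb{N}$. For a sequence $(y_n)_{n\in\mathbb{N}}$ in $X$, $\mathcal{C}((y_n)_{n\in\mathbb{N}})$ denotes the set of all $y\in X$ that are the weak limit of some subsequence of $(y_n)_{n\in\mathbb{N}}$ (in finite dimensions, this is the set of usual cluster points). $\mathbb{S}=\{x\in X:\|x\|=1\}$ is the unit sphere. For $z\in C\subseteq X$, the normal cone of $C$ at $z$ is $N_C(z)=\{u\in X:\langle c-z,u\rangle\le 0 \text{ for all } c\in C\}$. The distance function of $C$ is $d_C(x)=\inf_{c\in C}\|c-x\|$. *)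

theory Defs
  imports "HOL-Analysis.Analysis"
begin

definition fejer_monotone :: "'a::real_inner set \<Rightarrow> (nat \<Rightarrow> 'a) \<Rightarrow> bool" where
  "fejer_monotone C x \<longleftrightarrow> (\<forall>c\<in>C. \<forall>n. norm (x (Suc n) - c) \<le> norm (x n - c))"

(* Weak convergence is tested against the vectors of the space, which represent all continuous
   linear functionals when the space is complete (Riesz). *)
definition weakly_converges :: "(nat \<Rightarrow> 'a::real_inner) \<Rightarrow> 'a \<Rightarrow> bool" where
  "weakly_converges y l \<longleftrightarrow> (\<forall>u. (\<lambda>n. inner (y n) u) \<longlonglongrightarrow> inner l u)"

definition weak_cluster_points :: "(nat \<Rightarrow> 'a::real_inner) \<Rightarrow> 'a set" where
  "weak_cluster_points y =
     {l. \<exists>r :: nat \<Rightarrow> nat. strict_mono r \<and> weakly_converges (y \<circ> r) l}"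

(* Only meant for z in C. *)
definition normal_cone :: "'a::real_inner set \<Rightarrow> 'a \<Rightarrow> 'a set" where
  "normal_cone C z = {u. \<forall>c\<in>C. inner (c - z) u \<le> 0}"

(* Valued in the extended reals so that the distance to the empty set is infinity; the library's
   infdist assigns it the value 0, which would make convergence to 0 trivial for an empty set. *)
definition dist_fun :: "'a::real_normed_vector set \<Rightarrow> 'a \<Rightarrow> ereal" where
  "dist_fun C x = (INF c\<in>C. ereal (norm (c - x)))"

end

theory Submission
  imports Defs
begin

text \<open>
  Fejer monotonicity says that each point of \<open>Z\<close> is at least as close to a later term of the
  sequence as to an earlier one, and, by passing to the limit, at least as close to \<open>zbar\<close> as to
  any term. So both statements concern steps from a point \<open>a\<close> to a point \<open>b\<close> that bring one closer
  (weakly) to every \<open>c \<in> Z\<close>. Expanding the square in \<open>norm (b - c) \<le> norm (a - c)\<close> shows that the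
  unit vector \<open>u\<close> along \<open>a - b\<close> satisfies \<open>inner (c - b) u \<le> norm (a - b) / 2\<close>. If \<open>a\<close> and \<open>b\<close>
  both tend to \<open>zbar\<close>, the right-hand side vanishes in the limit, so every cluster point of these
  unit vectors lies in the normal cone of \<open>Z\<close> at \<open>zbar\<close>
  (\<open>normalized_step_limit_in_normal_cone\<close>); it is a unit vector because weak and strong convergence
  agree in finite dimension.

  The distance formulation follows by compactness of the unit sphere: a sequence in a compact set
  approaches any set that contains all its cluster points
  (\<open>dist_fun_tendsto_0_if_cluster_points_in\<close>).
\<close>

lemma weakly_converges_iff_tendsto:
  fixes y :: "nat \<Rightarrow> 'a::euclidean_space"
  shows "weakly_converges y l \<longleftrightarrow> y \<longlonglongrightarrow> l"
proof
  assume "weakly_converges y l"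
  then show "y \<longlonglongrightarrow> l"
    by (subst tendsto_componentwise_iff) (simp add: weakly_converges_def)
next
  assume "y \<longlonglongrightarrow> l"
  then show "weakly_converges y l"
    unfolding weakly_converges_def by (intro allI tendsto_intros)
qed

lemma weak_cluster_points_euclidean:
  fixes y :: "nat \<Rightarrow> 'a::euclidean_space"
  shows "weak_cluster_points y = {l. \<exists>r::nat \<Rightarrow> nat. strict_mono r \<and> (y \<circ> r) \<longlonglongrightarrow> l}"
  by (simp add: weak_cluster_points_def weakly_converges_iff_tendsto)

lemma dist_fun_nonneg: "0 \<le> dist_fun S x"
  by (simp add: dist_fun_def le_INF_iff)

lemma dist_fun_le: "l \<in> S \<Longrightarrow> dist_fun S x \<le> ereal (norm (l - x))"
  unfolding dist_fun_def by (rule INF_lower)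

text \<open>
  If the distances did not tend to zero, they would stay above some \<open>\<epsilon> > 0\<close> along a subsequence;
  compactness gives it a cluster point \<open>l\<close>, which lies in \<open>S\<close>, yet the distance to \<open>S\<close> is at most
  the distance to \<open>l\<close>. Since \<open>dist_fun\<close> is infinite for the empty set, the conclusion includes
  that \<open>S\<close> is nonempty.
\<close>

lemma dist_fun_tendsto_0_if_cluster_points_in:
  fixes y :: "nat \<Rightarrow> 'a::real_normed_vector"
  assumes "compact K" and "\<And>n. y n \<in> K"
    and cluster: "\<And>r l. strict_mono (r :: nat \<Rightarrow> nat) \<Longrightarrow> (y \<circ> r) \<longlonglongrightarrow> l \<Longrightarrow> l \<in> S"
  shows "(\<lambda>n. dist_fun S (y n)) \<longlonglongrightarrow> 0"
proof (rule order_tendstoI)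
  fix a :: ereal assume "a < 0"
  then show "\<forall>\<^sub>F n in sequentially. a < dist_fun S (y n)"
    using dist_fun_nonneg[of S] by (intro always_eventually allI) (rule less_le_trans)
next
  fix \<epsilon> :: ereal assume "0 < \<epsilon>"
  show "\<forall>\<^sub>F n in sequentially. dist_fun S (y n) < \<epsilon>"
  proof (rule ccontr)
    assume "\<not> ?thesis"
    then have "infinite {n. \<epsilon> \<le> dist_fun S (y n)}"
      by (simp add: not_eventually not_less frequently_cofinite
          flip: cofinite_eq_sequentially)
    then obtain r :: "nat \<Rightarrow> nat" where r: "strict_mono r" "\<And>n. \<epsilon> \<le> dist_fun S (y (r n))"
      using infinite_enumerate by blast
    obtain l s where s: "strict_mono (s :: nat \<Rightarrow> nat)" "((y \<circ> r) \<circ> s) \<longlonglongrightarrow> l"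
      using assms(1,2) unfolding compact_def by (metis comp_apply)
    have "l \<in> S"
      using cluster[of "r \<circ> s" l] r(1) s by (simp add: strict_mono_o o_assoc)
    then have bound: "\<epsilon> \<le> ereal (norm (l - y (r (s n))))" for n
      using r(2)[of "s n"] dist_fun_le order_trans by blast
    have "(\<lambda>n. norm (l - y (r (s n)))) \<longlonglongrightarrow> norm (l - l)"
      using s(2) by (intro tendsto_intros) (simp add: o_def)
    then have "(\<lambda>n. ereal (norm (l - y (r (s n))))) \<longlonglongrightarrow> 0"
      by (simp add: zero_ereal_def)
    then have "\<epsilon> \<le> 0"
      by (rule LIMSEQ_le_const) (simp add: bound)
    with \<open>0 < \<epsilon>\<close> show False
      by simp
  qed
qed

lemma inner_normalized_step_le:
  fixes a b c :: "'a::real_inner"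
  assumes "norm (b - c) \<le> norm (a - c)"
  shows "inner (c - b) ((a - b) /\<^sub>R norm (a - b)) \<le> norm (a - b) / 2"
proof (cases "a = b")
  case False
  have "(norm (a - c))\<^sup>2 = (norm (a - b))\<^sup>2 - 2 * inner (c - b) (a - b) + (norm (b - c))\<^sup>2"
    by (simp add: power2_norm_eq_inner inner_diff_left inner_diff_right inner_commute)
  moreover have "(norm (b - c))\<^sup>2 \<le> (norm (a - c))\<^sup>2"
    using assms by (simp add: power_mono)
  ultimately have "inner (c - b) (a - b) \<le> norm (a - b) * norm (a - b) / 2"
    by (simp add: power2_eq_square)
  with False show ?thesis
    by (simp add: divide_simps mult.commute)
qed simp

lemma normalized_step_limit_in_normal_cone:
  fixes a b :: "nat \<Rightarrow> 'a::real_inner"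
  assumes "a \<longlonglongrightarrow> z" and "b \<longlonglongrightarrow> z"
    and closer: "\<And>c n. c \<in> Z \<Longrightarrow> norm (b n - c) \<le> norm (a n - c)"
    and u: "(\<lambda>n. (a n - b n) /\<^sub>R norm (a n - b n)) \<longlonglongrightarrow> u"
  shows "u \<in> normal_cone Z z"
  unfolding normal_cone_def
proof (intro CollectI ballI)
  fix c assume "c \<in> Z"
  have lim: "(\<lambda>n. inner (c - b n) ((a n - b n) /\<^sub>R norm (a n - b n))) \<longlonglongrightarrow> inner (c - z) u"
    by (intro tendsto_intros assms)
  have half: "(\<lambda>n. norm (a n - b n) / 2) \<longlonglongrightarrow> norm (z - z) / 2"
    by (intro tendsto_intros assms) simp
  have "inner (c - b n) ((a n - b n) /\<^sub>R norm (a n - b n)) \<le> norm (a n - b n) / 2" for n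
    using closer[OF \<open>c \<in> Z\<close>] by (rule inner_normalized_step_le)
  then have "inner (c - z) u \<le> norm (z - z) / 2"
    using LIMSEQ_le[OF lim half] by simp
  then show "inner (c - z) u \<le> 0"
    by simp
qed

text \<open>
  Keeping the end points \<open>b n\<close> arbitrary treats both families of unit vectors at once: \<open>b n\<close> is the
  next term of the subsequence for the one and constantly its limit for the other.
\<close>

lemma normalized_steps_approach_normal_cone:
  fixes a b :: "nat \<Rightarrow> 'a::euclidean_space"
  assumes "a \<longlonglongrightarrow> z" and "b \<longlonglongrightarrow> z" and "\<And>n. a n \<noteq> b n"
    and closer: "\<And>c n. c \<in> Z \<Longrightarrow> norm (b n - c) \<le> norm (a n - c)"
  defines "y \<equiv> \<lambda>n. (a n - b n) /\<^sub>R norm (a n - b n)"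
  shows "weak_cluster_points y \<subseteq> sphere 0 1 \<inter> normal_cone Z z"
    and "(\<lambda>n. dist_fun (sphere 0 1 \<inter> normal_cone Z z) (y n)) \<longlonglongrightarrow> 0"
proof -
  have unit: "y n \<in> sphere 0 1" for n
    using assms(3) by (simp add: y_def)
  have cluster: "l \<in> sphere 0 1 \<inter> normal_cone Z z"
    if r: "strict_mono (r :: nat \<Rightarrow> nat)" and l: "(y \<circ> r) \<longlonglongrightarrow> l" for r l
  proof
    show "l \<in> sphere 0 1"
      by (rule closed_sequentially[OF closed_sphere _ l]) (use unit in simp)
    show "l \<in> normal_cone Z z"
    proof (rule normalized_step_limit_in_normal_cone)
      show "(a \<circ> r) \<longlonglongrightarrow> z" "(b \<circ> r) \<longlonglongrightarrow> z"
        using assms(1,2) r by (auto intro: LIMSEQ_subseq_LIMSEQ)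
      show "(\<lambda>n. ((a \<circ> r) n - (b \<circ> r) n) /\<^sub>R norm ((a \<circ> r) n - (b \<circ> r) n)) \<longlonglongrightarrow> l"
        using l by (simp add: y_def o_def)
    qed (simp add: closer)
  qed
  show "weak_cluster_points y \<subseteq> sphere 0 1 \<inter> normal_cone Z z"
    unfolding weak_cluster_points_euclidean using cluster by blast
  show "(\<lambda>n. dist_fun (sphere 0 1 \<inter> normal_cone Z z) (y n)) \<longlonglongrightarrow> 0"
    using compact_sphere unit cluster by (rule dist_fun_tendsto_0_if_cluster_points_in)
qed

lemma fejer_monotone_antimono:
  assumes "fejer_monotone C x" and "c \<in> C" and "m \<le> n"
  shows "norm (x n - c) \<le> norm (x m - c)"
  using assms(1,2) by (intro lift_Suc_antimono_le[OF _ assms(3)]) (simp add: fejer_monotone_def)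

lemma fejer_monotone_subseq_limit_le:
  assumes "fejer_monotone C x" and "c \<in> C" and "strict_mono k" and "(\<lambda>n. x (k n)) \<longlonglongrightarrow> z"
  shows "norm (z - c) \<le> norm (x m - c)"
proof (rule LIMSEQ_le_const2)
  show "(\<lambda>n. norm (x (k n) - c)) \<longlonglongrightarrow> norm (z - c)"
    by (intro tendsto_intros assms)
  have "norm (x (k n) - c) \<le> norm (x m - c)" if "m \<le> n" for n
    using that seq_suble[OF assms(3), of n] by (intro fejer_monotone_antimono[OF assms(1,2)]) simp
  then show "\<exists>N. \<forall>n\<ge>N. norm (x (k n) - c) \<le> norm (x m - c)"
    by blast
qed

theorem corollary3p3:
  fixes Z :: "'a::euclidean_space set"
    and x :: "nat \<Rightarrow> 'a"
    and k :: "nat \<Rightarrow> nat"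
    and zbar :: 'a
  assumes "Z \<noteq> {}" and "closed Z" and "convex Z"
    and "fejer_monotone Z x"
    and "strict_mono k"
    and "zbar \<in> Z"
    and "(\<lambda>n. x (k n)) \<longlonglongrightarrow> zbar"
    and "\<And>n. x (k (Suc n)) \<noteq> x (k n)"
    and "\<And>n. x (k n) \<noteq> zbar"
  shows "(weak_cluster_points (\<lambda>n. (x (k n) - x (k (Suc n))) /\<^sub>R norm (x (k n) - x (k (Suc n))))
           \<union> weak_cluster_points (\<lambda>n. (x (k n) - zbar) /\<^sub>R norm (x (k n) - zbar))
         \<subseteq> sphere 0 1 \<inter> normal_cone Z zbar)
       \<and> ((\<lambda>n. dist_fun (sphere 0 1 \<inter> normal_cone Z zbar)
              ((x (k n) - x (k (Suc n))) /\<^sub>R norm (x (k n) - x (k (Suc n))))) \<longlonglongrightarrow> 0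
         \<and> (\<lambda>n. dist_fun (sphere 0 1 \<inter> normal_cone Z zbar)
              ((x (k n) - zbar) /\<^sub>R norm (x (k n) - zbar))) \<longlonglongrightarrow> 0)"
proof -
  have later: "norm (x (k (Suc n)) - c) \<le> norm (x (k n) - c)" if "c \<in> Z" for c n
    using assms(4,5) that by (intro fejer_monotone_antimono) (auto simp: strict_mono_less_eq)
  have limit: "norm (zbar - c) \<le> norm (x (k n) - c)" if "c \<in> Z" for c n
    using assms(4) that assms(5,7) by (rule fejer_monotone_subseq_limit_le)
  have shifted: "(\<lambda>n. x (k (Suc n))) \<longlonglongrightarrow> zbar"
    using assms(7) by (rule LIMSEQ_Suc)
  note steps = normalized_steps_approach_normal_cone
    [OF assms(7) shifted assms(8)[symmetric] later, of Z]
  note offsets = normalized_steps_approach_normal_cone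
    [OF assms(7) tendsto_const assms(9) limit, of Z]
  show ?thesis
    using steps offsets by blast
qed

end
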